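(* Let $X$ and $Y$ be real Banach spaces, and let $\rho\colon(X,+)\to\operatorname{Isom}_{\mathrm{lin}}(\operatorname{Lip}_0(X,Y))$, $a\mapsto\rho_a$, be the isometric representation given by $(\rho_af)(x)=f(x+a)-f(a)$ for $f\in\operatorname{Lip}_0(X,Y)$ and $a,x\in X$. Then the fixed-point space of $\rho$ coincides with the space of bounded linear operators from $X$ into $Y$: $$\operatorname{Fix}(\rho):=\bigcap_{a\in X}\ker\bigl(\rho_a-I_{\operatorname{Lip}_0(X,Y)}\bigr)=\mathcal L(X,Y).$$ Equivalently, for $f\in\operatorname{Lip}_0(X,Y)$, $f\in\mathcal L(X,Y)$ if and only if $\rho_af=f$ for every $a\in X$.
   Context: $\operatorname{Lip}_0(X,Y)$ is the Banach space of Lipschitz maps $f\colon X\to Y$ with $f(0)=0$, normed by the least Lipschitz constant $\operatorname{Lip}(f)$. $\mathcal L(X,Y)$ is the space of bounded linear operators, regarded as a subset of $\operatorname{Lip}_0(X,Y)$. $\operatorname{Isom}_{\mathrm{lin}}(Z)$ is the group of surjective linear isometries of a Banach space $Z$. *)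

theory Defs
  imports "HOL-Analysis.Analysis"
begin

section \<open>The Banach space of Lipschitz maps vanishing at the origin\<close>

typedef (overloaded) ('a, 'b) lip0 =
  "{f :: 'a::real_normed_vector \<Rightarrow> 'b::real_normed_vector.
      (\<exists>C. C-lipschitz_on UNIV f) \<and> f 0 = 0}"
  morphisms lip0_apply Lip0
proof
  show "(\<lambda>_. 0) \<in> {f :: 'a \<Rightarrow> 'b. (\<exists>C. C-lipschitz_on UNIV f) \<and> f 0 = 0}"
    by (auto simp: lipschitz_on_def)
qed

declare [[coercion
  "lip0_apply :: ('a::real_normed_vector, 'b::real_normed_vector) lip0 \<Rightarrow> 'a \<Rightarrow> 'b"]]

setup_lifting type_definition_lip0

lemma lip0_eqI: "(\<And>x. lip0_apply f x = lip0_apply g x) \<Longrightarrow> f = g"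
  by transfer auto

definition lip_const :: "('a::metric_space \<Rightarrow> 'b::metric_space) \<Rightarrow> real" where
  "lip_const f = Inf {C. C-lipschitz_on UNIV f}"

lemma bdd_below_lipschitz_constants: "bdd_below {C. C-lipschitz_on UNIV f}"
  by (auto intro!: bdd_belowI[of _ 0] dest: lipschitz_on_nonneg)

lemma lip_const_le: "C-lipschitz_on UNIV f \<Longrightarrow> lip_const f \<le> C"
  unfolding lip_const_def by (intro cInf_lower bdd_below_lipschitz_constants) simp

text \<open>The infimum is attained, i.e. it is the least Lipschitz constant.\<close>

lemma lipschitz_on_lip_const:
  assumes "\<exists>C. C-lipschitz_on UNIV f"
  shows "(lip_const f)-lipschitz_on UNIV f"
proof (rule lipschitz_onI)
  have ne: "{C. C-lipschitz_on UNIV f} \<noteq> {}" using assms by auto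
  show "0 \<le> lip_const f"
    unfolding lip_const_def by (rule cInf_greatest[OF ne]) (auto dest: lipschitz_on_nonneg)
  fix x y
  show "dist (f x) (f y) \<le> lip_const f * dist x y"
  proof (cases "x = y")
    case False
    have "dist (f x) (f y) / dist x y \<le> lip_const f"
      unfolding lip_const_def
    proof (rule cInf_greatest[OF ne])
      fix C assume "C \<in> {C. C-lipschitz_on UNIV f}"
      then have "dist (f x) (f y) \<le> C * dist x y" by (auto dest: lipschitz_onD)
      then show "dist (f x) (f y) / dist x y \<le> C" using False by (simp add: field_simps)
    qed
    then show ?thesis using False by (simp add: field_simps)
  qed simp
qed

lemma lipschitz_on_UNIV_iff_norm:
  fixes f :: "'a::real_normed_vector \<Rightarrow> 'b::real_normed_vector"
  shows "C-lipschitz_on UNIV f \<longleftrightarrow> 0 \<le> C \<and> (\<forall>x y. norm (f x - f y) \<le> C * norm (x - y))"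
  by (auto simp: lipschitz_on_def dist_norm)

lemma lipschitz_on_add_UNIV:
  fixes f g :: "'a::real_normed_vector \<Rightarrow> 'b::real_normed_vector"
  assumes "C-lipschitz_on UNIV f" "D-lipschitz_on UNIV g"
  shows "(C + D)-lipschitz_on UNIV (\<lambda>x. f x + g x)"
proof (rule lipschitz_onI)
  fix x y
  have "dist (f x + g x) (f y + g y) \<le> dist (f x) (f y) + dist (g x) (g y)"
    by (rule dist_triangle_add)
  also have "\<dots> \<le> C * dist x y + D * dist x y"
    using assms by (intro add_mono) (auto dest: lipschitz_onD)
  finally show "dist (f x + g x) (f y + g y) \<le> (C + D) * dist x y"
    by (simp add: algebra_simps)
qed (use assms in \<open>auto dest!: lipschitz_on_nonneg\<close>)

lemma lipschitz_on_scaleR_UNIV: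
  fixes f :: "'a::real_normed_vector \<Rightarrow> 'b::real_normed_vector"
  assumes "C-lipschitz_on UNIV f"
  shows "(\<bar>r\<bar> * C)-lipschitz_on UNIV (\<lambda>x. r *\<^sub>R f x)"
  using assms
  by (auto simp: lipschitz_on_def dist_norm mult.assoc simp flip: scaleR_right_diff_distrib
    intro!: mult_left_mono)

lemma lipschitz_on_minus_UNIV:
  fixes f :: "'a::real_normed_vector \<Rightarrow> 'b::real_normed_vector"
  assumes "C-lipschitz_on UNIV f"
  shows "C-lipschitz_on UNIV (\<lambda>x. - f x)"
  using lipschitz_on_scaleR_UNIV[OF assms, of "-1"] by simp

instantiation lip0 :: (real_normed_vector, real_normed_vector) real_normed_vector
begin

lift_definition norm_lip0 :: "('a, 'b) lip0 \<Rightarrow> real" is lip_const .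

lift_definition zero_lip0 :: "('a, 'b) lip0" is "\<lambda>_. 0"
  by (auto simp: lipschitz_on_def)

lift_definition plus_lip0 :: "('a, 'b) lip0 \<Rightarrow> ('a, 'b) lip0 \<Rightarrow> ('a, 'b) lip0"
  is "\<lambda>f g x. f x + g x"
  by (auto dest: lipschitz_on_add_UNIV)

lift_definition uminus_lip0 :: "('a, 'b) lip0 \<Rightarrow> ('a, 'b) lip0" is "\<lambda>f x. - f x"
  by (auto dest: lipschitz_on_minus_UNIV)

lift_definition minus_lip0 :: "('a, 'b) lip0 \<Rightarrow> ('a, 'b) lip0 \<Rightarrow> ('a, 'b) lip0"
  is "\<lambda>f g x. f x - g x"
  using lipschitz_on_add_UNIV[OF _ lipschitz_on_minus_UNIV] by fastforce

lift_definition scaleR_lip0 :: "real \<Rightarrow> ('a, 'b) lip0 \<Rightarrow> ('a, 'b) lip0"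
  is "\<lambda>r f x. r *\<^sub>R f x"
  by (auto dest: lipschitz_on_scaleR_UNIV)

definition dist_lip0 :: "('a, 'b) lip0 \<Rightarrow> ('a, 'b) lip0 \<Rightarrow> real"
  where "dist_lip0 f g = norm (f - g)"

definition uniformity_lip0 :: "(('a, 'b) lip0 \<times> ('a, 'b) lip0) filter"
  where "uniformity_lip0 = (INF e\<in>{0 <..}. principal {(x, y). dist x y < e})"

definition open_lip0 :: "('a, 'b) lip0 set \<Rightarrow> bool"
  where "open_lip0 S = (\<forall>x\<in>S. \<forall>\<^sub>F (x', y) in uniformity. x' = x \<longrightarrow> y \<in> S)"

definition sgn_lip0 :: "('a, 'b) lip0 \<Rightarrow> ('a, 'b) lip0"
  where "sgn_lip0 f = inverse (norm f) *\<^sub>R f"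

lemma lipschitz_on_norm_lip0: "(norm f)-lipschitz_on UNIV (lip0_apply f)"
  for f :: "('a, 'b) lip0"
  by transfer (auto intro: lipschitz_on_lip_const)

lemma norm_lip0_le: "C-lipschitz_on UNIV (lip0_apply f) \<Longrightarrow> norm f \<le> C"
  for f :: "('a, 'b) lip0"
  by transfer (auto intro: lip_const_le)

lemma norm_lip0_diff_le: "norm (lip0_apply f x - lip0_apply f y) \<le> norm f * norm (x - y)"
  for f :: "('a, 'b) lip0"
  using lipschitz_on_norm_lip0 by (auto simp: lipschitz_on_UNIV_iff_norm)

lemma norm_scaleR_lip0_le: "norm (r *\<^sub>R f) \<le> \<bar>r\<bar> * norm f" for f :: "('a, 'b) lip0"
  by (rule norm_lip0_le)
    (simp add: scaleR_lip0.rep_eq lipschitz_on_scaleR_UNIV lipschitz_on_norm_lip0)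

instance
proof
  fix f g h :: "('a, 'b) lip0" and r s :: real
  show "f + g + h = f + (g + h)" by transfer (simp add: algebra_simps)
  show "f + g = g + f" by transfer (simp add: algebra_simps)
  show "0 + f = f" by transfer simp
  show "- f + f = 0" by transfer simp
  show "f - g = f + - g" by transfer simp
  show "r *\<^sub>R (f + g) = r *\<^sub>R f + r *\<^sub>R g" by transfer (simp add: algebra_simps)
  show "(r + s) *\<^sub>R f = r *\<^sub>R f + s *\<^sub>R f" by transfer (simp add: algebra_simps)
  show "r *\<^sub>R s *\<^sub>R f = (r * s) *\<^sub>R f" by transfer simp
  show "1 *\<^sub>R f = f" by transfer simp
  show "dist f g = norm (f - g)" by (rule dist_lip0_def)
  show "sgn f = inverse (norm f) *\<^sub>R f" by (rule sgn_lip0_def)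
  show "(uniformity :: (('a, 'b) lip0 \<times> ('a, 'b) lip0) filter)
      = (INF e\<in>{0 <..}. principal {(x, y). dist x y < e})"
    by (rule uniformity_lip0_def)
  show "open S = (\<forall>x\<in>S. \<forall>\<^sub>F (x', y) in uniformity. x' = x \<longrightarrow> y \<in> S)"
    for S :: "('a, 'b) lip0 set"
    by (rule open_lip0_def)
  show "norm (f + g) \<le> norm f + norm g"
    by (rule norm_lip0_le)
      (simp add: plus_lip0.rep_eq lipschitz_on_add_UNIV lipschitz_on_norm_lip0)
  show "norm (r *\<^sub>R f) = \<bar>r\<bar> * norm f"
  proof (rule antisym)
    show "\<bar>r\<bar> * norm f \<le> norm (r *\<^sub>R f)"
    proof (cases "r = 0")
      case True
      then show ?thesis using lipschitz_on_nonneg[OF lipschitz_on_norm_lip0] by auto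
    next
      case False
      then have "f = inverse r *\<^sub>R (r *\<^sub>R f)" by transfer simp
      then have "norm f \<le> \<bar>inverse r\<bar> * norm (r *\<^sub>R f)"
        using norm_scaleR_lip0_le[of "inverse r" "r *\<^sub>R f"] by simp
      then show ?thesis using False by (simp add: field_simps)
    qed
  qed (rule norm_scaleR_lip0_le)
  show "norm f = 0 \<longleftrightarrow> f = 0"
  proof
    assume "norm f = 0"
    then have "lip0_apply f x = 0" for x
      using norm_lip0_diff_le[of f x 0] lip0_apply[of f] by simp
    then show "f = 0" by (intro lip0_eqI) (simp add: zero_lip0.rep_eq)
  next
    assume "f = 0"
    then have "norm f \<le> 0"
      by (intro norm_lip0_le) (simp add: zero_lip0.rep_eq lipschitz_on_def)
    then show "norm f = 0"
      using lipschitz_on_nonneg[OF lipschitz_on_norm_lip0[of f]] by simp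
  qed
qed

end

lemma lip0_apply_0 [simp]: "lip0_apply f 0 = 0"
  using lip0_apply[of f] by simp

instance lip0 :: (real_normed_vector, banach) banach
proof
  fix F :: "nat \<Rightarrow> ('a, 'b) lip0"
  assume F: "Cauchy F"
  have "Cauchy (\<lambda>n. F n x)" for x
  proof (rule CauchyI)
    fix e :: real assume "0 < e"
    then have "0 < e / (norm x + 1)" by (simp add: add_nonneg_pos)
    from CauchyD[OF F this] obtain M
      where M: "\<And>m n. M \<le> m \<Longrightarrow> M \<le> n \<Longrightarrow> norm (F m - F n) < e / (norm x + 1)" by blast
    have "norm (F m x - F n x) < e" if "M \<le> m" "M \<le> n" for m n
    proof -
      have "norm (F m x - F n x) \<le> norm (F m - F n) * norm x"
        using norm_lip0_diff_le[of "F m - F n" x 0] by (simp add: minus_lip0.rep_eq)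
      also have "\<dots> \<le> norm (F m - F n) * (norm x + 1)" by (simp add: mult_left_mono)
      also have "\<dots> < e"
        using M[OF that] by (simp add: pos_less_divide_eq add_nonneg_pos)
      finally show ?thesis .
    qed
    then show "\<exists>M. \<forall>m\<ge>M. \<forall>n\<ge>M. norm (F m x - F n x) < e" by blast
  qed
  then have "\<exists>l. (\<lambda>n. F n x) \<longlonglongrightarrow> l" for x
    by (simp add: Cauchy_convergent_iff convergent_def)
  then obtain v where v: "\<And>x. (\<lambda>n. F n x) \<longlonglongrightarrow> v x" by metis
  have close: "e-lipschitz_on UNIV (\<lambda>x. F m x - v x)"
    if "0 < e" and M: "\<And>n. M \<le> n \<Longrightarrow> norm (F m - F n) < e" for e m M
    unfolding lipschitz_on_UNIV_iff_norm
  proof (intro conjI allI)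
    fix x y
    have "(\<lambda>n. norm ((F m x - F n x) - (F m y - F n y)))
        \<longlonglongrightarrow> norm ((F m x - v x) - (F m y - v y))"
      by (intro tendsto_intros v)
    moreover have "norm ((F m x - F n x) - (F m y - F n y)) \<le> e * norm (x - y)"
      if "M \<le> n" for n
    proof -
      have "norm ((F m x - F n x) - (F m y - F n y)) \<le> norm (F m - F n) * norm (x - y)"
        using norm_lip0_diff_le[of "F m - F n" x y] by (simp add: minus_lip0.rep_eq)
      also have "\<dots> \<le> e * norm (x - y)"
        using M[OF that] by (intro mult_right_mono) auto
      finally show ?thesis .
    qed
    ultimately show "norm ((F m x - v x) - (F m y - v y)) \<le> e * norm (x - y)"
      by (intro LIMSEQ_le_const2) auto
  qed (use that in simp)
  obtain M where "\<And>m n. M \<le> m \<Longrightarrow> M \<le> n \<Longrightarrow> norm (F m - F n) < 1"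
    using CauchyD[OF F, of 1] by auto
  then have "1-lipschitz_on UNIV (\<lambda>x. F M x - v x)" by (intro close[of _ M]) auto
  from lipschitz_on_add_UNIV[OF lipschitz_on_norm_lip0[of "F M"] lipschitz_on_minus_UNIV[OF this]]
  have "\<exists>C. C-lipschitz_on UNIV v" by auto
  moreover have "v 0 = 0" using LIMSEQ_unique[OF v[of 0]] by simp
  ultimately have V: "lip0_apply (Lip0 v) = v" by (simp add: Lip0_inverse)
  have "F \<longlonglongrightarrow> Lip0 v"
  proof (rule LIMSEQ_I)
    fix e :: real assume "0 < e"
    then have e: "0 < e / 2" by simp
    from CauchyD[OF F e] obtain M
      where M: "\<And>m n. M \<le> m \<Longrightarrow> M \<le> n \<Longrightarrow> norm (F m - F n) < e / 2" by blast
    have "norm (F m - Lip0 v) < e" if "M \<le> m" for m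
    proof -
      have "norm (F m - Lip0 v) \<le> e / 2"
        by (rule norm_lip0_le) (use close[OF e M[OF that]] in \<open>simp add: minus_lip0.rep_eq V\<close>)
      then show ?thesis using \<open>0 < e\<close> by simp
    qed
    then show "\<exists>M. \<forall>m\<ge>M. norm (F m - Lip0 v) < e" by blast
  qed
  then show "convergent F" by (auto simp: convergent_def)
qed


section \<open>Bounded linear operators as elements of \<open>lip0\<close>\<close>

lift_definition lip0_of_blinfun ::
    "('a::real_normed_vector \<Rightarrow>\<^sub>L 'b::real_normed_vector) \<Rightarrow> ('a, 'b) lip0"
  is "\<lambda>T. T"
proof -
  fix T :: "'a \<Rightarrow> 'b"
  assume T: "bounded_linear T"
  then have "norm (T x - T y) \<le> onorm T * norm (x - y)" for x y
    using onorm[OF T, of "x - y"] by (simp add: linear_simps)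
  then have "(onorm T)-lipschitz_on UNIV T"
    by (simp add: lipschitz_on_UNIV_iff_norm onorm_pos_le[OF T])
  then show "(\<exists>C. C-lipschitz_on UNIV T) \<and> T 0 = 0"
    using T by (auto simp: linear_simps)
qed

definition bounded_operators ::
    "('a::real_normed_vector, 'b::real_normed_vector) lip0 set" where
  "bounded_operators = range lip0_of_blinfun"

lemma mem_bounded_operators_iff:
  "f \<in> bounded_operators \<longleftrightarrow> bounded_linear (lip0_apply f)"
proof
  assume "bounded_linear (lip0_apply f)"
  then have "f = lip0_of_blinfun (Blinfun (lip0_apply f))"
    by (intro lip0_eqI) (simp add: lip0_of_blinfun.rep_eq bounded_linear_Blinfun_apply)
  then show "f \<in> bounded_operators" by (auto simp: bounded_operators_def)
qed (auto simp: bounded_operators_def lip0_of_blinfun.rep_eq blinfun.bounded_linear_right)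


section \<open>Isometric representations and their fixed points\<close>

definition Isom_lin :: "('z::real_normed_vector \<Rightarrow>\<^sub>L 'z) set" where
  "Isom_lin = {T. surj (blinfun_apply T) \<and> (\<forall>z. norm (blinfun_apply T z) = norm z)}"

text \<open>A group homomorphism from the additive group of \<open>'g\<close> to the group \<open>Isom_lin\<close>
  under composition.\<close>

definition isometric_representation ::
    "('g::group_add \<Rightarrow> ('z::real_normed_vector \<Rightarrow>\<^sub>L 'z)) \<Rightarrow> bool" where
  "isometric_representation \<rho> \<longleftrightarrow>
     (\<forall>a. \<rho> a \<in> Isom_lin) \<and> \<rho> 0 = id_blinfun \<and> (\<forall>a b. \<rho> (a + b) = \<rho> a o\<^sub>L \<rho> b)"

definition Fix :: "('g \<Rightarrow> ('z::real_normed_vector \<Rightarrow>\<^sub>L 'z)) \<Rightarrow> 'z set" where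
  "Fix \<rho> = (\<Inter>a. {z. blinfun_apply (\<rho> a - id_blinfun) z = 0})"

lemma lipschitz_on_translate:
  fixes f :: "'a::real_normed_vector \<Rightarrow> 'b::real_normed_vector"
  assumes "C-lipschitz_on UNIV f"
  shows "C-lipschitz_on UNIV (\<lambda>x. f (x + a) - f a)"
  using assms unfolding lipschitz_on_UNIV_iff_norm
  by (metis (no_types, lifting) add_diff_cancel_right diff_diff_eq2 diff_add_cancel)

lift_definition lip0_translate ::
    "'a \<Rightarrow> ('a::real_normed_vector, 'b::real_normed_vector) lip0 \<Rightarrow> ('a, 'b) lip0"
  is "\<lambda>a f x. f (x + a) - f a"
  by (auto dest: lipschitz_on_translate)

lemma bounded_linear_lip0_translate: "bounded_linear (lip0_translate a)"
proof (rule bounded_linear_intro[where K = 1])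
  show "lip0_translate a (f + g) = lip0_translate a f + lip0_translate a g" for f g
    by transfer (simp add: algebra_simps)
  show "lip0_translate a (r *\<^sub>R f) = r *\<^sub>R lip0_translate a f" for r f
    by transfer (simp add: algebra_simps)
  show "norm (lip0_translate a f) \<le> norm f * 1" for f
    unfolding mult_1_right
    by (rule norm_lip0_le)
      (simp add: lip0_translate.rep_eq lipschitz_on_translate lipschitz_on_norm_lip0)
qed

lift_definition lip0_rep ::
    "'a \<Rightarrow> (('a::real_normed_vector, 'b::real_normed_vector) lip0 \<Rightarrow>\<^sub>L ('a, 'b) lip0)"
  is lip0_translate
  by (rule bounded_linear_lip0_translate)

lemma lip0_rep_apply: "lip0_apply (blinfun_apply (lip0_rep a) f) x = f (x + a) - f a"
  by (simp add: lip0_rep.rep_eq lip0_translate.rep_eq)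

end

theory Submission
  imports Defs
begin

text \<open>
  The map \<open>\<rho>\<^sub>a\<close> precomposes \<open>f\<close> with a translation and renormalises it at the origin. Increments
  of \<open>f\<close> are therefore only translated, which does not increase the Lipschitz constant. As
  \<open>\<rho>\<^sub>-\<^sub>a\<close> inverts \<open>\<rho>\<^sub>a\<close>, every \<open>\<rho>\<^sub>a\<close> is a surjective isometry.

  The equation \<open>\<rho>\<^sub>a f = f\<close> for all \<open>a\<close> says \<open>f (x + a) = f x + f a\<close>, which is exactly additivity.
  So the content of the theorem is that an additive Lipschitz map is real-linear
  (\<open>additive_lipschitz_imp_bounded_linear\<close>). For fixed \<open>x\<close>, the defect
  \<open>g r = f (r x) - r f x\<close> is additive in \<open>r\<close> and vanishes at \<open>1\<close>, so it factors through the
  fractional part of \<open>r\<close> and is bounded by the Lipschitz estimate; a bounded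
  additive map vanishes, since \<open>n g r = g (n r)\<close> stays bounded as \<open>n\<close> grows.
\<close>

lemma additive_scaleR_of_nat:
  fixes f :: "'a::real_vector \<Rightarrow> 'b::real_vector"
  assumes add: "\<And>x y. f (x + y) = f x + f y"
  shows "f (real n *\<^sub>R x) = real n *\<^sub>R f x"
proof (induction n)
  case 0
  show ?case using add[of 0 0] by simp
next
  case (Suc n)
  then show ?case by (simp add: add algebra_simps)
qed

lemma additive_scaleR_of_int:
  fixes f :: "'a::real_vector \<Rightarrow> 'b::real_vector"
  assumes add: "\<And>x y. f (x + y) = f x + f y"
  shows "f (of_int k *\<^sub>R x) = of_int k *\<^sub>R f x"
proof -
  interpret additive f by standard (rule add)
  show ?thesis
    by (cases k rule: int_cases2) (simp_all add: additive_scaleR_of_nat[of f, OF add] minus)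
qed

text \<open>The multiples \<open>n g x = g (n x)\<close> of a nonzero value \<open>g x\<close> would be unbounded.\<close>

lemma additive_bounded_imp_zero:
  fixes g :: "'a::real_vector \<Rightarrow> 'b::real_normed_vector"
  assumes add: "\<And>x y. g (x + y) = g x + g y" and bound: "\<And>x. norm (g x) \<le> B"
  shows "g x = 0"
proof (rule ccontr)
  assume "g x \<noteq> 0"
  then obtain n where "B < real n * norm (g x)"
    using reals_Archimedean3[of "norm (g x)"] by auto
  also have "\<dots> = norm (g (real n *\<^sub>R x))"
    by (simp add: additive_scaleR_of_nat[of g, OF add])
  also have "\<dots> \<le> B" by (rule bound)
  finally show False by simp
qed

text \<open>Only homogeneity is at stake. The Lipschitz bound serves twice: it controls the defect
  \<open>f (s x) - s f x\<close> for \<open>s\<close> in the unit interval, and then it is the operator bound.\<close>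

lemma additive_lipschitz_imp_bounded_linear:
  fixes f :: "'a::real_normed_vector \<Rightarrow> 'b::real_normed_vector"
  assumes add: "\<And>x y. f (x + y) = f x + f y" and lip: "C-lipschitz_on UNIV f"
  shows "bounded_linear f"
proof -
  interpret additive f by standard (rule add)
  have growth: "norm (f x) \<le> C * norm x" for x
    using lipschitz_onD[OF lip, of x 0] by (simp add: zero)
  have C: "0 \<le> C" using lip by (rule lipschitz_on_nonneg)
  have "f (r *\<^sub>R x) = r *\<^sub>R f x" for r x
  proof -
    define g where "g s = f (s *\<^sub>R x) - s *\<^sub>R f x" for s
    have g_add: "g (s + t) = g s + g t" for s t
      by (simp add: g_def add scaleR_left_distrib)
    have "norm (g s) \<le> C * norm x + norm (f x)" for s
    proof -
      \<comment> \<open>\<open>g\<close> vanishes at integers, so it has period \<open>1\<close>.\<close>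
      have "g s = g (of_int \<lfloor>s\<rfloor> + frac s)" by (simp add: frac_def)
      also have "\<dots> = g (frac s)"
        by (simp only: g_add) (simp add: g_def additive_scaleR_of_int[of f, OF add])
      finally have "norm (g s) \<le> norm (f (frac s *\<^sub>R x)) + norm (frac s *\<^sub>R f x)"
        by (simp only: g_def norm_triangle_ineq4)
      also have "norm (f (frac s *\<^sub>R x)) \<le> C * norm (frac s *\<^sub>R x)" by (rule growth)
      also have "norm (frac s *\<^sub>R x) \<le> norm x"
        using frac_lt_1[of s] by (simp add: mult_left_le_one_le less_imp_le)
      also have "norm (frac s *\<^sub>R f x) \<le> norm (f x)"
        using frac_lt_1[of s] by (simp add: mult_left_le_one_le less_imp_le)
      finally show ?thesis using C by (simp add: mult_left_mono)
    qed
    then have "g r = 0" using g_add by (intro additive_bounded_imp_zero[of g]) auto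
    then show ?thesis by (simp add: g_def)
  qed
  then show ?thesis
    using growth by (intro bounded_linear_intro[where K = C]) (auto simp: add mult.commute)
qed

lemma lip0_rep_0: "lip0_rep 0 = id_blinfun"
  by (intro blinfun_eqI lip0_eqI) (simp add: lip0_rep_apply)

lemma lip0_rep_add: "lip0_rep (a + b) = lip0_rep a o\<^sub>L lip0_rep b"
  by (intro blinfun_eqI lip0_eqI) (simp add: lip0_rep_apply algebra_simps)

lemma norm_lip0_rep_le: "norm (blinfun_apply (lip0_rep a) f) \<le> norm f"
proof (rule norm_lip0_le)
  have "lip0_apply (blinfun_apply (lip0_rep a) f) = (\<lambda>x. f (x + a) - f a)"
    by (simp add: fun_eq_iff lip0_rep_apply)
  then show "(norm f)-lipschitz_on UNIV (lip0_apply (blinfun_apply (lip0_rep a) f))"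
    by (simp add: lipschitz_on_translate lipschitz_on_norm_lip0)
qed

lemma lip0_rep_uminus: "blinfun_apply (lip0_rep a) (blinfun_apply (lip0_rep (- a)) f) = f"
  using lip0_rep_add[of a "- a"]
  by (metis add.right_inverse blinfun_apply_blinfun_compose id_blinfun.rep_eq lip0_rep_0)

text \<open>A group of contractions consists of isometries: the contraction estimate for \<open>\<rho>\<^sub>-\<^sub>a\<close> is the
  lower estimate for its inverse \<open>\<rho>\<^sub>a\<close>.\<close>

lemma isometric_representation_lip0_rep: "isometric_representation lip0_rep"
proof -
  have "norm (blinfun_apply (lip0_rep a) f) = norm f" for a :: 'a and f :: "('a, 'b) lip0"
    using norm_lip0_rep_le[of a f] norm_lip0_rep_le[of "- a" "blinfun_apply (lip0_rep a) f"]
      lip0_rep_uminus[of "- a" f]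
    by simp
  moreover have "surj (blinfun_apply (lip0_rep a :: ('a, 'b) lip0 \<Rightarrow>\<^sub>L _))" for a :: 'a
    using lip0_rep_uminus by (rule surjI)
  ultimately show ?thesis
    by (simp add: isometric_representation_def Isom_lin_def lip0_rep_0 lip0_rep_add)
qed

lemma lip0_rep_fixed_iff_additive:
  "(\<forall>a. blinfun_apply (lip0_rep a) f = f) \<longleftrightarrow>
    (\<forall>x y. lip0_apply f (x + y) = lip0_apply f x + lip0_apply f y)"
proof -
  have "blinfun_apply (lip0_rep a) f = f \<longleftrightarrow> (\<forall>x. f (x + a) = f x + f a)" for a
    by (metis lip0_rep_apply lip0_eqI diff_eq_eq)
  then show ?thesis by auto
qed

lemma bounded_operators_iff_lip0_rep_fixed:
  "f \<in> bounded_operators \<longleftrightarrow> (\<forall>a. blinfun_apply (lip0_rep a) f = f)"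
  unfolding mem_bounded_operators_iff lip0_rep_fixed_iff_additive
  using additive_lipschitz_imp_bounded_linear[OF _ lipschitz_on_norm_lip0]
  by (auto simp: linear_simps)

lemma mem_Fix_iff: "z \<in> Fix \<rho> \<longleftrightarrow> (\<forall>a. blinfun_apply (\<rho> a) z = z)"
  by (simp add: Fix_def blinfun.diff_left)

theorem theorem4p4:
  shows "isometric_representation
           (lip0_rep :: 'a::banach \<Rightarrow> (('a, 'b::banach) lip0 \<Rightarrow>\<^sub>L ('a, 'b) lip0)) \<and>
         Fix (lip0_rep :: 'a \<Rightarrow> (('a, 'b) lip0 \<Rightarrow>\<^sub>L ('a, 'b) lip0)) = bounded_operators \<and>
         (\<forall>f :: ('a, 'b) lip0.
            f \<in> bounded_operators \<longleftrightarrow> (\<forall>a. blinfun_apply (lip0_rep a) f = f))"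
  using isometric_representation_lip0_rep bounded_operators_iff_lip0_rep_fixed
  by (auto simp: mem_Fix_iff)

end
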